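(* We have $$\tilde{\mathfrak{S}}(132,213)^{\mathsf{des},\mathsf{iar},\mathsf{comp}}(t,r,p)=\frac{1}{1-rpz}+\frac{tz}{(1-rz)(1-z-tz)},$$ $$\tilde{\mathfrak{S}}(132,231)^{\mathsf{des},\mathsf{iar},\mathsf{comp}}(t,r,p)=\frac{1}{1-rpz}+\frac{tz}{(1-pz)(1-z-tz)}.$$
   Context: $\mathfrak{S}_n$ is the set of permutations $\pi=\pi(1)\cdots\pi(n)$ of $[n]=\{1,\dots,n\}$. A permutation $\pi\in\mathfrak{S}_n$ contains the pattern $\sigma\in\mathfrak{S}_k$ if there are $j_1<\cdots<j_k$ such that $\pi(j_a)<\pi(j_b)$ if and only if $\sigma(a)<\sigma(b)$ for all $1\le a<b\le k$; otherwise it avoids $\sigma$. For a set $P$ of patterns, $\mathfrak{S}_n(P)$ is the set of $\pi\in\mathfrak{S}_n$ avoiding every pattern in $P$. For $\pi\in\mathfrak{S}_n$: $\mathrm{DES}(\pi)=\{i\in[n-1]:\pi(i)>\pi(i+1)\}$, $\mathsf{des}(\pi)=|\mathrm{DES}(\pi)|$, $\mathsf{iar}(\pi)=\min(\mathrm{DES}(\pi)\cup\{n\})$, $\mathsf{comp}(\pi)=|\{i\in[n]:\pi(j)\le i\text{ for all }j\le i\}|$. Define the formal power series in $z$ $$\mathfrak{S}(P)^{\mathsf{des},\mathsf{iar},\mathsf{comp}}(t,r,p;z)=\sum_{n\ge0}z^n\sum_{\pi\in\mathfrak{S}_n(P)}t^{\mathsf{des}(\pi)}r^{\mathsf{iar}(\pi)}p^{\mathsf{comp}(\pi)},$$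 where the empty permutation ($n=0$) contributes $1$, and $\tilde{\mathfrak{S}}(P)^{\mathsf{des},\mathsf{iar},\mathsf{comp}}(t,r,p)=\big(\mathfrak{S}(P)^{\mathsf{des},\mathsf{iar},\mathsf{comp}}(t,r,p;z)-1\big)/(rpz)$. *)

theory Defs
  imports
    "HOL-Computational_Algebra.Computational_Algebra"
    "HOL-Combinatorics.Combinatorics"
begin

text \<open>
  A permutation of \<open>{1..n}\<close> is its one-line word, an element of
  \<open>permutations_of_set {1..n}\<close>. Library lists are indexed from 0, so positions are
  accessed through \<open>entry\<close>, which counts them from 1.
\<close>

definition entry :: "nat list \<Rightarrow> nat \<Rightarrow> nat" where
  "entry \<pi> i = \<pi> ! (i - 1)"

definition contains :: "nat list \<Rightarrow> nat list \<Rightarrow> bool" where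
  "contains \<pi> \<sigma> \<longleftrightarrow>
     (\<exists>j :: nat \<Rightarrow> nat.
        strict_mono_on {1..length \<sigma>} j \<and> j ` {1..length \<sigma>} \<subseteq> {1..length \<pi>} \<and>
        (\<forall>a b. 1 \<le> a \<and> a < b \<and> b \<le> length \<sigma> \<longrightarrow>
               (entry \<pi> (j a) < entry \<pi> (j b) \<longleftrightarrow> entry \<sigma> a < entry \<sigma> b)))"

definition avoiders :: "nat \<Rightarrow> nat list set \<Rightarrow> nat list set" where
  "avoiders n P = {\<pi> \<in> permutations_of_set {1..n}. \<forall>\<sigma>\<in>P. \<not> contains \<pi> \<sigma>}"

definition DES :: "nat list \<Rightarrow> nat set" where
  "DES \<pi> = {i. 1 \<le> i \<and> i < length \<pi> \<and> entry \<pi> i > entry \<pi> (i + 1)}"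

definition des :: "nat list \<Rightarrow> nat" where
  "des \<pi> = card (DES \<pi>)"

definition iar :: "nat list \<Rightarrow> nat" where
  "iar \<pi> = Min (DES \<pi> \<union> {length \<pi>})"

definition ncomp :: "nat list \<Rightarrow> nat" where
  "ncomp \<pi> = card {i \<in> {1..length \<pi>}. \<forall>j\<in>{1..i}. entry \<pi> j \<le> i}"

definition perm_gf :: "nat list set \<Rightarrow> 'a \<Rightarrow> 'a \<Rightarrow> 'a \<Rightarrow> 'a :: field fps" where
  "perm_gf P t r p =
     Abs_fps (\<lambda>n. \<Sum>\<pi>\<in>avoiders n P. t ^ des \<pi> * r ^ iar \<pi> * p ^ ncomp \<pi>)"

text \<open>
  Division of power series over a field discards any part of the numerator that is not divisible;
  the lemma \<open>perm_gf_tilde_times\<close> shows that nothing is discarded here.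
\<close>

definition perm_gf_tilde :: "nat list set \<Rightarrow> 'a \<Rightarrow> 'a \<Rightarrow> 'a \<Rightarrow> 'a :: field fps" where
  "perm_gf_tilde P t r p = (perm_gf P t r p - 1) / (fps_const r * fps_const p * fps_X)"

lemma perm_gf_nth_0:
  assumes "[] \<notin> P"
  shows "fps_nth (perm_gf P t r p) 0 = 1"
proof -
  have "\<not> contains [] \<sigma>" if "\<sigma> \<in> P" for \<sigma>
  proof -
    have "length \<sigma> \<ge> 1"
      using that assms by (cases \<sigma>) auto
    then show ?thesis
      by (auto simp: contains_def)
  qed
  then have "avoiders 0 P = {[]}"
    by (auto simp: avoiders_def)
  moreover have "DES [] = {}"
    by (auto simp: DES_def)
  moreover have "{i \<in> {1..length ([] :: nat list)}. \<forall>j\<in>{1..i}. entry [] j \<le> i} = {}"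
    by auto
  then have "ncomp [] = 0"
    by (simp only: ncomp_def card.empty)
  ultimately show ?thesis
    by (simp add: perm_gf_def des_def iar_def)
qed

lemma perm_gf_tilde_times:
  assumes "[] \<notin> P" "r \<noteq> 0" "p \<noteq> 0"
  shows "perm_gf_tilde P t r p * (fps_const r * fps_const p * fps_X) = perm_gf P t r p - 1"
proof -
  let ?f = "perm_gf P t r p - 1"
  have "fps_nth ?f 0 = 0"
    using perm_gf_nth_0[OF assms(1)] by simp
  then have "?f = fps_X * fps_shift 1 ?f"
    by (intro fps_ext) (simp split: nat.splits)
  also have "\<dots> = (fps_const r * fps_const p * fps_X) *
                   (fps_const (inverse (r * p)) * fps_shift 1 ?f)"
  proof -
    have "fps_const r * fps_const p * fps_const (inverse (r * p)) = 1"
      using assms by (simp add: field_simps)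
    then show ?thesis
      by (metis (no_types, lifting) mult.assoc mult.commute mult_1)
  qed
  finally have "fps_const r * fps_const p * fps_X dvd ?f"
    by (metis dvd_triv_left)
  then show ?thesis
    by (simp add: perm_gf_tilde_def)
qed

text \<open>
  The three independent indeterminates, in the field of fractions of the polynomial ring in
  \<open>t\<close>, \<open>r\<close> and \<open>p\<close> over the integers.
\<close>

type_synonym rat_fun = "int poly poly poly fract"

definition t_var :: rat_fun where "t_var = to_fract [:[:[:0, 1:]:]:]"
definition r_var :: rat_fun where "r_var = to_fract [:[:0, 1:]:]"
definition p_var :: rat_fun where "p_var = to_fract [:0, 1:]"

lemma r_var_nonzero: "r_var \<noteq> 0" and p_var_nonzero: "p_var \<noteq> 0"
  by (simp_all add: r_var_def p_var_def)

end

theory Submission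
  imports Defs
begin

text \<open>
  In both classes the first entry \<open>a\<close> of a word determines almost everything. Avoiding \<open>132\<close>
  forces the entries larger than \<open>a\<close> to appear in increasing order, so they form the single word
  \<open>a+1, ..., n\<close>. Avoiding \<open>213\<close> in addition forbids a smaller entry before a larger one, and
  avoiding \<open>231\<close> forbids a larger entry before a smaller one. With \<open>a = m + 1\<close>, the words of
  length \<open>n > 0\<close> are therefore, respectively,

    \<open>(m+1) (m+2) ... n \<tau>\<close>  and  \<open>(m+1) \<tau> (m+2) ... n\<close>

  where \<open>m < n\<close> and \<open>\<tau>\<close> is any avoider of length \<open>m\<close>; no standardisation is involved, because
  the entries smaller than \<open>a\<close> are exactly \<open>1, ..., m\<close>. These are the bijections
  \<open>bij_betw_avoiders_132_213\<close> and \<open>bij_betw_avoiders_132_231\<close>.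

  For \<open>m = 0\<close> the word is the identity, with no descent and with \<open>iar = comp = n\<close>; these words
  yield the summand \<open>1 / (1 - r p z)\<close>. For \<open>m > 0\<close> exactly one new descent is created, and
  the remaining two statistics do not depend on \<open>\<tau>\<close>: \<open>iar = n - m\<close> and \<open>comp = 1\<close> in the first
  class, \<open>iar = 1\<close> and \<open>comp = n - m\<close> in the second. So only the descent polynomial \<open>D\<^sub>m(t)\<close> of the
  smaller avoiders is needed. It satisfies \<open>D\<^sub>n = 1 + t (D\<^sub>1 + ... + D\<^sub>n\<^sub>-\<^sub>1)\<close>, whence
  \<open>D\<^sub>m = (1 + t)\<^sup>m\<^sup>-\<^sup>1\<close>. After division by \<open>r p z\<close>, the words with \<open>m > 0\<close> contribute to the
  coefficient of \<open>z\<^sup>k\<close> the convolution of \<open>t (1 + t)\<^sup>j\<close> with the powers of \<open>c\<close>, where \<open>c\<close> is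
  \<open>r\<close> for the first class and \<open>p\<close> for the second. The lemma \<open>perm_gf_tilde_of_decomposition\<close>
  carries this out for both classes at once.
\<close>

section \<open>Patterns of length three\<close>

definition order_iso3 :: "nat \<Rightarrow> nat \<Rightarrow> nat \<Rightarrow> nat \<Rightarrow> nat \<Rightarrow> nat \<Rightarrow> bool" where
  "order_iso3 a b c x y z \<longleftrightarrow> (x < y \<longleftrightarrow> a < b) \<and> (x < z \<longleftrightarrow> a < c) \<and> (y < z \<longleftrightarrow> b < c)"

text \<open>
  Recursion on the word turns a forbidden pattern into conditions \<open>sorted_wrt\<close> on pairs of later
  entries; these are stable under filtering and concatenation, the two operations that the
  decomposition by the first entry uses.
\<close>

fun no_triple :: "('a \<Rightarrow> 'a \<Rightarrow> 'a \<Rightarrow> bool) \<Rightarrow> 'a list \<Rightarrow> bool" where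
  "no_triple Q [] \<longleftrightarrow> True"
| "no_triple Q (x # xs) \<longleftrightarrow> sorted_wrt (\<lambda>y z. \<not> Q x y z) xs \<and> no_triple Q xs"

lemma no_triple_iff_nth:
  "no_triple Q xs \<longleftrightarrow> (\<forall>i j k. i < j \<and> j < k \<and> k < length xs \<longrightarrow> \<not> Q (xs ! i) (xs ! j) (xs ! k))"
proof (induction xs)
  case (Cons x xs)
  have *: "(\<forall>i j k. i < j \<and> j < k \<and> k < length (x # xs) \<longrightarrow>
              \<not> Q ((x # xs) ! i) ((x # xs) ! j) ((x # xs) ! k)) \<longleftrightarrow>
        (\<forall>j k. j < k \<and> k < length xs \<longrightarrow> \<not> Q x (xs ! j) (xs ! k)) \<and>
        (\<forall>i j k. i < j \<and> j < k \<and> k < length xs \<longrightarrow> \<not> Q (xs ! i) (xs ! j) (xs ! k))"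
    (is "?L \<longleftrightarrow> ?R1 \<and> ?R2")
  proof (intro iffI conjI)
    assume L: ?L
    show ?R1
    proof (intro allI impI)
      fix j k assume "j < k \<and> k < length xs"
      then show "\<not> Q x (xs ! j) (xs ! k)"
        using L[rule_format, of 0 "Suc j" "Suc k"] by simp
    qed
    show ?R2
    proof (intro allI impI)
      fix i j k assume "i < j \<and> j < k \<and> k < length xs"
      then show "\<not> Q (xs ! i) (xs ! j) (xs ! k)"
        using L[rule_format, of "Suc i" "Suc j" "Suc k"] by simp
    qed
  next
    assume R: "?R1 \<and> ?R2"
    show ?L
    proof (intro allI impI)
      fix i j k assume A: "i < j \<and> j < k \<and> k < length (x # xs)"
      then obtain j' k' where "j = Suc j'" "k = Suc k'"
        by (metis less_zeroE not0_implies_Suc)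
      with A R show "\<not> Q ((x # xs) ! i) ((x # xs) ! j) ((x # xs) ! k)"
        by (cases i) auto
    qed
  qed
  show ?case
    unfolding * by (simp add: Cons.IH sorted_wrt_iff_nth_less) blast
qed simp

lemma contains_iff_not_no_triple:
  "contains \<pi> [a, b, c] \<longleftrightarrow> \<not> no_triple (order_iso3 a b c) \<pi>"
proof
  assume "contains \<pi> [a, b, c]"
  then obtain j :: "nat \<Rightarrow> nat" where mono: "strict_mono_on {1..3} j"
    and ran: "j ` {1..3} \<subseteq> {1..length \<pi>}"
    and ord: "\<And>k l. 1 \<le> k \<Longrightarrow> k < l \<Longrightarrow> l \<le> 3 \<Longrightarrow>
               entry \<pi> (j k) < entry \<pi> (j l) \<longleftrightarrow> entry [a, b, c] k < entry [a, b, c] l"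
    by (auto simp: contains_def numeral_3_eq_3)
  have lt: "j 1 < j 2" "j 2 < j 3"
    using mono by (auto simp: strict_mono_on_def)
  have "j 1 \<ge> 1" "j 3 \<le> length \<pi>"
    using ran by (auto simp: image_subset_iff)
  with lt have "j 1 - 1 < j 2 - 1" "j 2 - 1 < j 3 - 1" "j 3 - 1 < length \<pi>"
    by linarith+
  moreover have "order_iso3 a b c (\<pi> ! (j 1 - 1)) (\<pi> ! (j 2 - 1)) (\<pi> ! (j 3 - 1))"
    using ord[of 1 2] ord[of 1 3] ord[of 2 3]
    by (simp add: order_iso3_def entry_def)
  ultimately show "\<not> no_triple (order_iso3 a b c) \<pi>"
    unfolding no_triple_iff_nth by blast
next
  assume "\<not> no_triple (order_iso3 a b c) \<pi>"
  then obtain i j k where ijk: "i < j" "j < k" "k < length \<pi>"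
    and Q: "order_iso3 a b c (\<pi> ! i) (\<pi> ! j) (\<pi> ! k)"
    unfolding no_triple_iff_nth by blast
  \<comment> \<open>Positions are counted from 1 in \<^const>\<open>contains\<close>, hence the successors.\<close>
  define f :: "nat \<Rightarrow> nat" where
    "f l = (if l = 1 then Suc i else if l = 2 then Suc j else Suc k)" for l
  have "strict_mono_on {1..length [a, b, c]} f"
    using ijk by (auto simp: strict_mono_on_def f_def)
  moreover have "f ` {1..length [a, b, c]} \<subseteq> {1..length \<pi>}"
    using ijk by (auto simp: f_def)
  moreover have "entry \<pi> (f l) < entry \<pi> (f l') \<longleftrightarrow> entry [a, b, c] l < entry [a, b, c] l'"
    if "1 \<le> l" "l < l'" "l' \<le> length [a, b, c]" for l l'
  proof -
    from that have "l = 1 \<and> l' = 2 \<or> l = 1 \<and> l' = 3 \<or> l = 2 \<and> l' = 3"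
      by auto
    with Q show ?thesis
      by (auto simp: f_def entry_def order_iso3_def)
  qed
  ultimately show "contains \<pi> [a, b, c]"
    unfolding contains_def by blast
qed

text \<open>
  A triple in a concatenation splits between the two parts in four ways, one for each conjunct.
\<close>

lemma no_triple_append:
  "no_triple Q (xs @ ys) \<longleftrightarrow> no_triple Q xs \<and> no_triple Q ys \<and>
     (\<forall>x\<in>set xs. sorted_wrt (\<lambda>y z. \<not> Q x y z) ys) \<and>
     (\<forall>z\<in>set ys. sorted_wrt (\<lambda>x y. \<not> Q x y z) xs)"
  by (induction xs) (auto simp: sorted_wrt_append)

lemma no_triple_filter: "no_triple Q xs \<Longrightarrow> no_triple Q (filter P xs)"
  by (induction xs) (auto simp: sorted_wrt_filter)

lemma no_triple_sorted_wrt: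
  assumes "sorted_wrt R xs" "\<And>x y z. R x y \<Longrightarrow> R x z \<Longrightarrow> R y z \<Longrightarrow> \<not> Q x y z"
  shows "no_triple Q xs"
  using assms(1)
proof (induction xs)
  case (Cons x xs)
  then show ?case
    using assms(2) by (auto intro: sorted_wrt_mono_rel[of _ R])
qed simp

lemma sorted_wrt_if_all:
  "(\<And>y z. y \<in> set xs \<Longrightarrow> z \<in> set xs \<Longrightarrow> R y z) \<Longrightarrow> sorted_wrt R xs"
  by (induction xs) auto

lemma partition_if_sorted_wrt:
  "sorted_wrt (\<lambda>y z. P z \<longrightarrow> P y) xs \<Longrightarrow> xs = filter P xs @ filter (\<lambda>x. \<not> P x) xs"
proof (induction xs)
  case (Cons x xs)
  show ?case
  proof (cases "P x")
    case False
    with Cons.prems have "\<forall>y\<in>set xs. \<not> P y" by auto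
    with False show ?thesis by simp
  qed (use Cons in auto)
qed simp

section \<open>Decomposition by the first entry\<close>

lemma avoiders_pair_iff:
  "\<pi> \<in> avoiders n {[a, b, c], [d, e, f]} \<longleftrightarrow>
     set \<pi> = {1..n} \<and> distinct \<pi> \<and> no_triple (order_iso3 a b c) \<pi> \<and> no_triple (order_iso3 d e f) \<pi>"
  by (auto simp: avoiders_def permutations_of_set_def contains_iff_not_no_triple)

lemma avoiders_pair_0: "avoiders 0 {[a, b, c], [d, e, f]} = {[]}"
  by (auto simp: avoiders_pair_iff)

lemma finite_avoiders: "finite (avoiders n P)"
  by (simp add: avoiders_def)

lemma length_avoiders: "\<pi> \<in> avoiders n P \<Longrightarrow> length \<pi> = n"
  by (auto simp: avoiders_def permutations_of_set_def dest: distinct_card)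

lemma set_avoiders: "\<pi> \<in> avoiders n P \<Longrightarrow> set \<pi> = {1..n}"
  by (auto simp: avoiders_def permutations_of_set_def)

text \<open>
  An inversion among the entries larger than the first entry \<open>a\<close> would complete a \<open>132\<close> with
  \<open>a\<close> as its smallest letter, and an increasing word is determined by its set of entries.
\<close>

lemma entries_after_first:
  assumes set: "set (a # xs) = {1..n}" and dist: "distinct (a # xs)"
    and avoid: "no_triple (order_iso3 1 3 2) (a # xs)"
  shows "filter (\<lambda>x. a < x) xs = [Suc a..<Suc n]"
    and "set (filter (\<lambda>x. \<not> a < x) xs) = {1..a - 1}"
proof -
  have xs: "set xs = {1..n} - {a}" "a \<in> {1..n}" 
    using set dist by auto
  have "sorted_wrt (\<lambda>y z. \<not> order_iso3 1 3 2 a y z) (filter (\<lambda>x. a < x) xs)"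
    using avoid by (simp add: sorted_wrt_filter)
  then have "sorted (filter (\<lambda>x. a < x) xs)"
    by (rule sorted_wrt_mono_rel[rotated]) (auto simp: order_iso3_def)
  then show "filter (\<lambda>x. a < x) xs = [Suc a..<Suc n]"
  proof (rule sorted_distinct_set_unique)
    show "set (filter (\<lambda>x. a < x) xs) = set [Suc a..<Suc n]"
      unfolding set_filter set_upt xs(1) by auto
    show "distinct (filter (\<lambda>x. a < x) xs)"
      using dist by simp
  qed (rule sorted_upt distinct_upt)+
  show "set (filter (\<lambda>x. \<not> a < x) xs) = {1..a - 1}"
    unfolding set_filter xs(1) using xs(2) by auto
qed

text \<open>
  The words produced here contain neither pattern: both patterns have their first letter below
  their last, so an occurrence cannot begin in the upper block and end in \<open>\<tau>\<close>; it would lie in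
  \<open>\<tau>\<close> or be increasing. Conversely, a smaller entry before a larger one would complete
  a \<open>213\<close> with the first entry.
\<close>

lemma bij_betw_avoiders_132_213:
  assumes "n > 0"
  shows "bij_betw (\<lambda>(m, \<tau>). [Suc m..<Suc n] @ \<tau>)
           (SIGMA m:{..<n}. avoiders m {[1,3,2], [2,1,3]}) (avoiders n {[1,3,2], [2,1,3]})"
proof (rule bij_betw_imageI)
  show "inj_on (\<lambda>(m, \<tau>). [Suc m..<Suc n] @ \<tau>) (SIGMA m:{..<n}. avoiders m {[1,3,2], [2,1,3]})"
    by (auto simp: inj_on_def upt_conv_Cons simp del: upt_Suc)
  show "(\<lambda>(m, \<tau>). [Suc m..<Suc n] @ \<tau>) ` (SIGMA m:{..<n}. avoiders m {[1,3,2], [2,1,3]})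
          = avoiders n {[1,3,2], [2,1,3]}" (is "?f ` ?S = ?A")
  proof (intro equalityI subsetI)
    fix \<pi> assume "\<pi> \<in> ?f ` ?S"
    then obtain m \<tau> where m: "m < n" and \<tau>: "\<tau> \<in> avoiders m {[1,3,2], [2,1,3]}"
      and \<pi>: "\<pi> = [Suc m..<Suc n] @ \<tau>"
      by auto
    \<comment> \<open>The condition on \<open>Q\<close> is the common weakening of the two patterns.\<close>
    have *: "no_triple Q \<pi>"
      if "no_triple Q \<tau>" and Q: "\<And>x y z. Q x y z \<Longrightarrow> x < z \<and> (y \<le> x \<or> z \<le> y)" 
      for Q :: "nat \<Rightarrow> nat \<Rightarrow> nat \<Rightarrow> bool"
      unfolding \<pi> no_triple_append
    proof (intro conjI ballI)
      show "no_triple Q [Suc m..<Suc n]"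
        by (rule no_triple_sorted_wrt[OF sorted_wrt_upt]) (use Q in force)
      show "sorted_wrt (\<lambda>y z. \<not> Q x y z) \<tau>" if "x \<in> set [Suc m..<Suc n]" for x
        by (rule sorted_wrt_if_all) (use that Q set_avoiders[OF \<tau>] in fastforce)
      show "sorted_wrt (\<lambda>x y. \<not> Q x y z) [Suc m..<Suc n]" if "z \<in> set \<tau>" for z
        by (rule sorted_wrt_if_all) (use that Q set_avoiders[OF \<tau>] in fastforce)
    qed (use that in auto)
    have "no_triple (order_iso3 1 3 2) \<pi>" "no_triple (order_iso3 2 1 3) \<pi>"
      by (rule *; use \<tau> in \<open>auto simp: avoiders_pair_iff order_iso3_def\<close>)+
    moreover have "set \<pi> = {1..n}" "distinct \<pi>"
      using \<tau> m by (auto simp: avoiders_pair_iff \<pi> simp del: upt_Suc)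
    ultimately show "\<pi> \<in> ?A"
      by (simp add: avoiders_pair_iff)
  next
    fix \<pi> assume \<pi>: "\<pi> \<in> ?A"
    with assms obtain a xs where \<pi>_eq: "\<pi> = a # xs"
      using length_avoiders[OF \<pi>] by (cases \<pi>) auto
    have a: "a \<in> {1..n}"
      using set_avoiders[OF \<pi>] unfolding \<pi>_eq by (simp only: list.set) blast
    define \<tau> where "\<tau> = filter (\<lambda>x. \<not> a < x) xs"
    have "sorted_wrt (\<lambda>y z. \<not> order_iso3 2 1 3 a y z) xs"
      using \<pi> \<pi>_eq by (auto simp: avoiders_pair_iff)
    then have "sorted_wrt (\<lambda>y z. a < z \<longrightarrow> a < y) xs"
      by (rule sorted_wrt_mono_rel[rotated]) (auto simp: order_iso3_def)
    then have "xs = filter (\<lambda>x. a < x) xs @ \<tau>"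
      unfolding \<tau>_def by (rule partition_if_sorted_wrt)
    moreover have fl: "filter (\<lambda>x. a < x) xs = [Suc a..<Suc n]" "set \<tau> = {1..a - 1}"
      unfolding \<tau>_def
      by (intro entries_after_first; use \<pi> \<pi>_eq in \<open>auto simp: avoiders_pair_iff\<close>)+
    ultimately have xs: "xs = [Suc a..<Suc n] @ \<tau>"
      by simp
    have "\<tau> \<in> avoiders (a - 1) {[1,3,2], [2,1,3]}"
      unfolding avoiders_pair_iff using \<pi> \<pi>_eq fl(2)
      by (auto simp: avoiders_pair_iff \<tau>_def intro: no_triple_filter)
    moreover have "\<pi> = ?f (a - 1, \<tau>)"
      using a by (simp add: \<pi>_eq xs upt_conv_Cons del: upt_Suc)
    ultimately show "\<pi> \<in> ?f ` ?S"
      using a by (intro image_eqI[where x = "(a - 1, \<tau>)"]) auto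
  qed
qed

text \<open>
  Both patterns have their largest letter in the middle, that is, they are peaks. Neither the
  initial entry, which exceeds all of \<open>\<tau>\<close>, nor the increasing final block can take part in a peak.
  Conversely, a larger entry before a smaller one would complete a \<open>231\<close> with the first entry.
\<close>

lemma bij_betw_avoiders_132_231:
  assumes "n > 0"
  shows "bij_betw (\<lambda>(m, \<tau>). Suc m # \<tau> @ [Suc (Suc m)..<Suc n])
           (SIGMA m:{..<n}. avoiders m {[1,3,2], [2,3,1]}) (avoiders n {[1,3,2], [2,3,1]})"
proof (rule bij_betw_imageI)
  show "inj_on (\<lambda>(m, \<tau>). Suc m # \<tau> @ [Suc (Suc m)..<Suc n])
          (SIGMA m:{..<n}. avoiders m {[1,3,2], [2,3,1]})"
    by (auto simp: inj_on_def simp del: upt_Suc)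
  show "(\<lambda>(m, \<tau>). Suc m # \<tau> @ [Suc (Suc m)..<Suc n]) ` (SIGMA m:{..<n}. avoiders m {[1,3,2], [2,3,1]})
          = avoiders n {[1,3,2], [2,3,1]}" (is "?f ` ?S = ?A")
  proof (intro equalityI subsetI)
    fix \<pi> assume "\<pi> \<in> ?f ` ?S"
    then obtain m \<tau> where m: "m < n" and \<tau>: "\<tau> \<in> avoiders m {[1,3,2], [2,3,1]}"
      and \<pi>: "\<pi> = Suc m # \<tau> @ [Suc (Suc m)..<Suc n]"
      by auto
    \<comment> \<open>Again \<open>Q\<close> stands for either pattern; the condition says that the triple is a peak.\<close>
    have *: "no_triple Q \<pi>"
      if "no_triple Q \<tau>" and Q: "\<And>x y z. Q x y z \<Longrightarrow> x < y \<and> z \<le> y" 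
      for Q :: "nat \<Rightarrow> nat \<Rightarrow> nat \<Rightarrow> bool"
    proof -
      have up: "sorted_wrt (\<lambda>y z. \<not> Q x y z) [Suc (Suc m)..<Suc n]" for x
        by (rule sorted_wrt_mono_rel[OF _ sorted_wrt_upt]) (use Q in force)
      have low: "\<not> Q x y z" if "y \<in> set \<tau>" "z \<in> set [Suc (Suc m)..<Suc n]" for x y z
        using that Q set_avoiders[OF \<tau>] by fastforce
      have "no_triple Q [Suc (Suc m)..<Suc n]"
        by (rule no_triple_sorted_wrt[OF sorted_wrt_upt]) (use Q in force)
      moreover have "sorted_wrt (\<lambda>x y. \<not> Q x y z) \<tau>" if "z \<in> set [Suc (Suc m)..<Suc n]" for z
        by (rule sorted_wrt_if_all) (use low that in blast)
      moreover have "sorted_wrt (\<lambda>y z. \<not> Q (Suc m) y z) \<tau>"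
        by (rule sorted_wrt_if_all) (use Q set_avoiders[OF \<tau>] in fastforce)
      ultimately show ?thesis
        using that(1) up low by (simp add: \<pi> no_triple_append sorted_wrt_append del: upt_Suc)
    qed
    have "no_triple (order_iso3 1 3 2) \<pi>" "no_triple (order_iso3 2 3 1) \<pi>"
      by (rule *; use \<tau> in \<open>auto simp: avoiders_pair_iff order_iso3_def\<close>)+
    moreover have "set \<pi> = {1..n} \<and> distinct \<pi>"
    proof -
      have "set \<tau> = {1..m}" "distinct \<tau>"
        using \<tau> by (simp_all add: avoiders_pair_iff)
      moreover have "insert (Suc m) ({1..m} \<union> {Suc (Suc m)..<Suc n}) = {1..n}"
        by (rule set_eqI; use m in \<open>simp only: insert_iff Un_iff atLeastAtMost_iff atLeastLessThan_iff\<close>; use m in arith)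
      moreover have "{1..m} \<inter> {Suc (Suc m)..<Suc n} = {}"
        by auto
      ultimately show ?thesis
        by (simp add: \<pi> del: upt_Suc)
    qed
    ultimately show "\<pi> \<in> ?A"
      unfolding avoiders_pair_iff by blast
  next
    fix \<pi> assume \<pi>: "\<pi> \<in> ?A"
    with assms obtain a xs where \<pi>_eq: "\<pi> = a # xs"
      using length_avoiders[OF \<pi>] by (cases \<pi>) auto
    have a: "a \<in> {1..n}"
      using set_avoiders[OF \<pi>] unfolding \<pi>_eq by (simp only: list.set) blast
    define \<tau> where "\<tau> = filter (\<lambda>x. \<not> a < x) xs"
    have "sorted_wrt (\<lambda>y z. \<not> order_iso3 2 3 1 a y z) xs"
      using \<pi> \<pi>_eq by (auto simp: avoiders_pair_iff)
    then have "sorted_wrt (\<lambda>y z. \<not> a < z \<longrightarrow> \<not> a < y) xs"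
      by (rule sorted_wrt_mono_rel[rotated]) (auto simp: order_iso3_def)
    then have "xs = \<tau> @ filter (\<lambda>x. a < x) xs"
      unfolding \<tau>_def using partition_if_sorted_wrt[of "\<lambda>x. \<not> a < x" xs] by simp
    moreover have fl: "filter (\<lambda>x. a < x) xs = [Suc a..<Suc n]" "set \<tau> = {1..a - 1}"
      unfolding \<tau>_def
      by (intro entries_after_first; use \<pi> \<pi>_eq in \<open>auto simp: avoiders_pair_iff\<close>)+
    ultimately have xs: "xs = \<tau> @ [Suc a..<Suc n]"
      by simp
    have "\<tau> \<in> avoiders (a - 1) {[1,3,2], [2,3,1]}"
      unfolding avoiders_pair_iff using \<pi> \<pi>_eq fl(2)
      by (auto simp: avoiders_pair_iff \<tau>_def intro: no_triple_filter)
    moreover have "\<pi> = ?f (a - 1, \<tau>)"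
      using a by (simp add: \<pi>_eq xs del: upt_Suc)
    ultimately show "\<pi> \<in> ?f ` ?S"
      using a by (intro image_eqI[where x = "(a - 1, \<tau>)"]) auto
  qed
qed

section \<open>Statistics of the decomposed words\<close>

lemma des_singleton: "des [x] = 0"
  by (auto simp: des_def DES_def)

lemma DES_Cons_Cons:
  "DES (x # y # xs) = (if y < x then {1} else {}) \<union> Suc ` DES (y # xs)"
proof (rule set_eqI)
  fix i
  show "i \<in> DES (x # y # xs) \<longleftrightarrow> i \<in> (if y < x then {1} else {}) \<union> Suc ` DES (y # xs)"
  proof (cases i)
    case (Suc k)
    then show ?thesis
      by (cases k) (auto simp: DES_def entry_def image_iff)
  qed (auto simp: DES_def)
qed

lemma finite_DES: "finite (DES \<pi>)"
  by (rule finite_subset[of _ "{..<length \<pi>}"]) (auto simp: DES_def)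

lemma des_Cons_Cons: "des (x # y # xs) = (if y < x then 1 else 0) + des (y # xs)"
proof -
  have "1 \<notin> Suc ` DES (y # xs)"
    by (auto simp: DES_def)
  then show ?thesis
    by (simp add: des_def DES_Cons_Cons finite_DES card_image)
qed

lemma des_append:
  assumes "xs \<noteq> []" "ys \<noteq> []"
  shows "des (xs @ ys) = des xs + (if hd ys < last xs then 1 else 0) + des ys"
  using assms(1)
proof (induction xs rule: list_nonempty_induct)
  case (single x)
  with assms(2) show ?case
    by (cases ys) (auto simp: des_Cons_Cons des_singleton)
next
  case (cons x xs)
  then show ?case
    by (cases xs) (auto simp: des_Cons_Cons)
qed

lemma DES_sorted:
  assumes "sorted xs"
  shows "DES xs = {}"
proof -
  have "entry xs i \<le> entry xs (Suc i)" if "i < length xs" for i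
    using assms that by (auto simp: entry_def intro: sorted_nth_mono)
  then show ?thesis by (auto simp: DES_def) (metis not_less)
qed

lemma des_sorted: "sorted xs \<Longrightarrow> des xs = 0"
  by (simp add: des_def DES_sorted)

lemma iar_sorted: "sorted xs \<Longrightarrow> iar xs = length xs"
  by (simp add: iar_def DES_sorted)

lemma iar_sorted_append:
  assumes "sorted xs" "xs \<noteq> []" "ys \<noteq> []" "hd ys < last xs"
  shows "iar (xs @ ys) = length xs"
  unfolding iar_def
proof (rule Min_eqI)
  have "length xs \<in> DES (xs @ ys)"
    using assms by (auto simp: DES_def entry_def nth_append last_conv_nth hd_conv_nth Suc_le_eq)
  then show "length xs \<in> DES (xs @ ys) \<union> {length (xs @ ys)}" by simp
  show "length xs \<le> i" if "i \<in> DES (xs @ ys) \<union> {length (xs @ ys)}" for i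
  proof (rule ccontr)
    assume "\<not> length xs \<le> i"
    with that have "i \<in> DES xs"
      by (auto simp: DES_def entry_def nth_append less_imp_diff_less split: if_splits)
    with assms(1) show False by (simp add: DES_sorted)
  qed
qed (simp add: finite_DES)

text \<open>
  Reading the condition on prefixes as sets makes it computable for a concatenation of blocks.
\<close>

lemma ncomp_take: "ncomp \<pi> = card {i \<in> {1..length \<pi>}. \<forall>v\<in>set (take i \<pi>). v \<le> i}"
proof -
  have "(\<forall>j\<in>{1..i}. entry \<pi> j \<le> i) \<longleftrightarrow> (\<forall>v\<in>set (take i \<pi>). v \<le> i)"
    if "i \<in> {1..length \<pi>}" for i
  proof -
    have "{1..i} = Suc ` {0..<i}"
      by (simp add: image_Suc_atLeastLessThan atLeastLessThanSuc_atLeastAtMost)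
    moreover have "set (take i \<pi>) = (!) \<pi> ` {0..<i}"
      using that by (simp add: nth_image)
    ultimately show ?thesis
      by (simp only: entry_def ball_simps) simp
  qed
  then show ?thesis
    unfolding ncomp_def by (intro arg_cong[where f = card]) auto
qed

lemma ncomp_identity: "ncomp [Suc 0..<Suc n] = n"
proof -
  have "{i \<in> {1..n}. \<forall>v\<in>set (take i [Suc 0..<Suc n]). v \<le> i} = {1..n}"
    by (auto simp del: upt_Suc simp: take_upt)
  then show ?thesis by (simp add: ncomp_take del: upt_Suc)
qed

text \<open>
  A prefix that ends inside the upper block has its last entry above its length, since the block
  starts above 1; a longer prefix contains \<open>n\<close>, so it must be the whole word.
\<close>

lemma ncomp_132_213_word:
  assumes "0 < m" "m < n" "set \<tau> = {1..m}" "length \<tau> = m"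
  shows "ncomp ([Suc m..<Suc n] @ \<tau>) = 1"
proof -
  let ?\<pi> = "[Suc m..<Suc n] @ \<tau>"
  have "{i \<in> {1..n}. \<forall>v\<in>set (take i ?\<pi>). v \<le> i} = {n}"
  proof (intro equalityI subsetI)
    fix i assume "i \<in> {i \<in> {1..n}. \<forall>v\<in>set (take i ?\<pi>). v \<le> i}"
    then have i: "1 \<le> i" "i \<le> n" "\<forall>v\<in>set (take i ?\<pi>). v \<le> i" by auto
    show "i \<in> {n}"
    proof (cases "i \<le> n - m")
      case True
      then have "m + i \<in> set (take i ?\<pi>)"
        using i(1) assms by (auto simp: take_upt simp del: upt_Suc)
      with i(3) assms(1) show ?thesis by fastforce
    next
      case False
      then have "n \<in> set (take i ?\<pi>)"
        using assms by (auto simp del: upt_Suc)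
      with i show ?thesis by fastforce
    qed
  next
    fix i assume "i \<in> {n}"
    then show "i \<in> {i \<in> {1..n}. \<forall>v\<in>set (take i ?\<pi>). v \<le> i}"
      using assms by (auto simp del: upt_Suc dest!: in_set_takeD)
  qed
  then show ?thesis
    using assms by (simp add: ncomp_take del: upt_Suc)
qed

text \<open>
  The entry \<open>m + 1\<close> in front ties the first \<open>m + 1\<close> positions into one component; after them
  every entry is a fixed point and a component of its own.
\<close>

lemma ncomp_132_231_word:
  assumes "m < n" "set \<tau> = {1..m}" "length \<tau> = m"
  shows "ncomp (Suc m # \<tau> @ [Suc (Suc m)..<Suc n]) = n - m"
proof -
  let ?\<pi> = "Suc m # \<tau> @ [Suc (Suc m)..<Suc n]"
  have "{i \<in> {1..n}. \<forall>v\<in>set (take i ?\<pi>). v \<le> i} = {Suc m..n}"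
  proof (intro equalityI subsetI)
    fix i assume "i \<in> {i \<in> {1..n}. \<forall>v\<in>set (take i ?\<pi>). v \<le> i}"
    then have "1 \<le> i" "i \<le> n" "\<forall>v\<in>set (take i ?\<pi>). v \<le> i" by auto
    then show "i \<in> {Suc m..n}"
      by (cases i) auto
  next
    fix i assume "i \<in> {Suc m..n}"
    moreover from this obtain k where k: "i = Suc m + k"
      by (metis atLeastAtMost_iff le_Suc_ex)
    moreover have "take i ?\<pi> = Suc m # \<tau> @ [Suc (Suc m)..<Suc i]"
      using assms \<open>i \<in> {Suc m..n}\<close> k by (simp add: take_upt del: upt_Suc)
    ultimately show "i \<in> {i \<in> {1..n}. \<forall>v\<in>set (take i ?\<pi>). v \<le> i}"
      using assms by (auto simp del: upt_Suc take_Suc_Cons take_append)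
  qed
  then show ?thesis
    using assms by (simp add: ncomp_take del: upt_Suc)
qed

section \<open>Generating functions\<close>

lemma inverse_geometric_fps:
  "inverse (1 - fps_const c * fps_X) = Abs_fps (\<lambda>n. (c :: 'a :: field) ^ n)"
proof -
  have "(1 - fps_const c * fps_X) * Abs_fps (\<lambda>n. c ^ n) = 1"
    by (rule fps_ext) (auto simp: algebra_simps power_eq_if fps_mult_left_const_nth)
  then show ?thesis
    by (metis fps_inverse_unique)
qed

lemma power_if_partial_sum_recursion:
  fixes D :: "nat \<Rightarrow> 'a :: comm_ring_1"
  assumes "\<And>k. D (Suc k) = 1 + (\<Sum>j<k. t * D (Suc j))"
  shows "D (Suc k) = (1 + t) ^ k"
proof (induction k)
  case 0
  show ?case using assms[of 0] by simp
next
  case (Suc k)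
  have "D (Suc (Suc k)) = D (Suc k) + t * D (Suc k)"
    using assms[of k] assms[of "Suc k"] by simp
  then show ?case
    by (simp add: Suc algebra_simps)
qed

text \<open>
  \<open>W n m \<tau>\<close> stands for the word of length \<open>n\<close> with first entry \<open>m + 1\<close> built from \<open>\<tau>\<close>. The
  classes differ only in which of \<open>iar\<close> and \<open>comp\<close> grows with the length of the increasing block
  of entries from \<open>m + 1\<close> to \<open>n\<close>; the parameter \<open>c\<close> is the variable that records it.
\<close>

lemma perm_gf_tilde_of_decomposition:
  fixes t r p c :: "'a :: field"
  assumes nz: "r \<noteq> 0" "p \<noteq> 0" and P: "[] \<notin> P" and P0: "avoiders 0 P = {[]}"
    and bij: "\<And>n. n > 0 \<Longrightarrow> bij_betw (\<lambda>(m, \<tau>). W n m \<tau>) (SIGMA m:{..<n}. avoiders m P) (avoiders n P)"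
    and des: "\<And>n m \<tau>. m < n \<Longrightarrow> \<tau> \<in> avoiders m P \<Longrightarrow>
                des (W n m \<tau>) = (if m = 0 then 0 else Suc (des \<tau>))"
    and weight: "\<And>n m \<tau>. m < n \<Longrightarrow> \<tau> \<in> avoiders m P \<Longrightarrow>
                r ^ iar (W n m \<tau>) * p ^ ncomp (W n m \<tau>) =
                  (if m = 0 then (r * p) ^ n else r * p * c ^ (n - m - 1))"
  shows "perm_gf_tilde P t r p =
           1 / (1 - fps_const r * fps_const p * fps_X) +
           fps_const t * fps_X / ((1 - fps_const c * fps_X) * (1 - fps_X - fps_const t * fps_X))"
proof -
  have sum_avoiders: "(\<Sum>\<pi>\<in>avoiders (Suc k) P. g \<pi>) =
      g (W (Suc k) 0 []) + (\<Sum>j<k. \<Sum>\<tau>\<in>avoiders (Suc j) P. g (W (Suc k) (Suc j) \<tau>))"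
    for g :: "nat list \<Rightarrow> 'a" and k
  proof -
    have "(\<Sum>\<pi>\<in>avoiders (Suc k) P. g \<pi>) =
            (\<Sum>(m, \<tau>)\<in>(SIGMA m:{..<Suc k}. avoiders m P). g (W (Suc k) m \<tau>))"
      using sum.reindex_bij_betw[OF bij[of "Suc k"], of g] by (simp add: case_prod_unfold)
    also have "\<dots> = (\<Sum>m<Suc k. \<Sum>\<tau>\<in>avoiders m P. g (W (Suc k) m \<tau>))"
      by (rule sum.Sigma[symmetric]) (auto simp: finite_avoiders)
    finally show ?thesis
      by (simp only: sum.lessThan_Suc_shift P0) simp
  qed
  \<comment> \<open>The descent polynomials; the word with \<open>m = 0\<close> is the summand 1 of the recursion.\<close>
  define D where "D m = (\<Sum>\<tau>\<in>avoiders m P. t ^ des \<tau>)" for m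
  have "D (Suc k) = 1 + (\<Sum>j<k. t * D (Suc j))" for k
    unfolding D_def sum_avoiders[of _ k] by (simp add: des P0 sum_distrib_left)
  then have D: "D (Suc k) = (1 + t) ^ k" for k
    by (rule power_if_partial_sum_recursion)
  have coeff: "fps_nth (perm_gf P t r p) (Suc k) =
          r * p * ((r * p) ^ k + t * (\<Sum>j<k. (1 + t) ^ j * c ^ (k - 1 - j)))" for k
  proof -
    have "fps_nth (perm_gf P t r p) (Suc k) = (r * p) ^ Suc k +
            (\<Sum>j<k. \<Sum>\<tau>\<in>avoiders (Suc j) P. t ^ Suc (des \<tau>) * (r * p * c ^ (k - 1 - j)))"
      unfolding perm_gf_def fps_nth_Abs_fps sum_avoiders[of _ k]
      by (simp add: des weight P0 mult.assoc)
    also have "(\<Sum>j<k. \<Sum>\<tau>\<in>avoiders (Suc j) P. t ^ Suc (des \<tau>) * (r * p * c ^ (k - 1 - j))) =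
            (\<Sum>j<k. t * D (Suc j) * (r * p * c ^ (k - 1 - j)))"
      by (simp add: D_def sum_distrib_left sum_distrib_right)
    finally show ?thesis
      by (simp add: D sum_distrib_left algebra_simps)
  qed
  let ?R = "1 / (1 - fps_const r * fps_const p * fps_X) +
           fps_const t * fps_X / ((1 - fps_const c * fps_X) * (1 - fps_X - fps_const t * fps_X))"
  have R: "?R = Abs_fps (\<lambda>n. (r * p) ^ n) +
             fps_const t * (fps_X * (Abs_fps (\<lambda>n. (1 + t) ^ n) * Abs_fps (\<lambda>n. c ^ n)))"
  proof -
    have *: "1 - fps_X - fps_const t * fps_X = 1 - fps_const (1 + t) * fps_X"
      by (simp add: algebra_simps flip: fps_const_add)
    have "1 / (1 - fps_const r * fps_const p * fps_X) = inverse (1 - fps_const (r * p) * fps_X)"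
      by (simp add: fps_divide_unit)
    moreover have "fps_const t * fps_X / ((1 - fps_const c * fps_X) * (1 - fps_const (1 + t) * fps_X)) =
        fps_const t * fps_X * (inverse (1 - fps_const c * fps_X) * inverse (1 - fps_const (1 + t) * fps_X))"
      by (simp add: fps_divide_unit fps_inverse_mult)
    ultimately show ?thesis
      unfolding * inverse_geometric_fps by (simp add: mult_ac)
  qed
  have nth_R: "fps_nth ?R k = (r * p) ^ k + t * (\<Sum>j<k. (1 + t) ^ j * c ^ (k - 1 - j))" for k
  proof -
    have conv: "fps_nth (Abs_fps (\<lambda>n. (1 + t) ^ n) * Abs_fps (\<lambda>n. c ^ n)) n =
                  (\<Sum>j<Suc n. (1 + t) ^ j * c ^ (n - j))" for n
      by (simp add: fps_mult_nth atLeast0AtMost lessThan_Suc_atMost)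
    show ?thesis
      unfolding R by (cases k) (simp_all add: conv del: sum.lessThan_Suc)
  qed
  have "perm_gf P t r p - 1 = ?R * (fps_const r * fps_const p * fps_X)"
  proof (rule fps_ext)
    fix n
    show "fps_nth (perm_gf P t r p - 1) n = fps_nth (?R * (fps_const r * fps_const p * fps_X)) n"
    proof (cases n)
      case 0
      then show ?thesis using perm_gf_nth_0[OF P] by simp
    next
      case (Suc k)
      have "fps_nth (?R * (fps_const r * fps_const p * fps_X)) n = r * p * fps_nth ?R k"
        using Suc by (simp add: mult.assoc[symmetric] mult.commute[of ?R] fps_mult_left_const_nth
            del: fps_const_mult fps_add_nth)
      then show ?thesis
        unfolding nth_R using Suc by (simp add: coeff)
    qed
  qed
  then have "perm_gf_tilde P t r p * (fps_const r * fps_const p * fps_X) =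
             ?R * (fps_const r * fps_const p * fps_X)"
    using perm_gf_tilde_times[OF P nz] by simp
  then show ?thesis
    using nz by (metis (no_types, lifting) fps_X_neq_zero fps_const_nonzero_eq_nonzero mult_eq_0_iff mult_right_cancel)
qed

section \<open>The two pattern classes\<close>

lemma hd_less_Suc:
  assumes "\<tau> \<in> avoiders m P" "m \<noteq> 0"
  shows "\<tau> \<noteq> []" "hd \<tau> < Suc m"
proof -
  show "\<tau> \<noteq> []" using assms length_avoiders by fastforce
  then show "hd \<tau> < Suc m"
    using set_avoiders[OF assms(1)] hd_in_set by fastforce
qed

lemma perm_gf_tilde_132_213:
  fixes t r p :: "'a :: field"
  assumes "r \<noteq> 0" "p \<noteq> 0"
  shows "perm_gf_tilde {[1,3,2], [2,1,3]} t r p =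
           1 / (1 - fps_const r * fps_const p * fps_X) +
           fps_const t * fps_X / ((1 - fps_const r * fps_X) * (1 - fps_X - fps_const t * fps_X))"
proof (rule perm_gf_tilde_of_decomposition[OF assms _ avoiders_pair_0 bij_betw_avoiders_132_213])
  fix n m \<tau> assume m: "m < n" and \<tau>: "\<tau> \<in> avoiders m {[1,3,2], [2,1,3]}"
  let ?\<pi> = "[Suc m..<Suc n] @ \<tau>"
  have up: "sorted [Suc m..<Suc n]" "[Suc m..<Suc n] \<noteq> []"
    using m by (auto simp del: upt_Suc)
  have last: "last [Suc m..<Suc n] = n"
    using m by simp
  show "des ?\<pi> = (if m = 0 then 0 else Suc (des \<tau>))"
  proof (cases "m = 0")
    case True
    with \<tau> up show ?thesis by (simp add: avoiders_pair_0 des_sorted del: upt_Suc)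
  next
    case False
    with hd_less_Suc[OF \<tau>] up last m show ?thesis
      by (simp add: des_append des_sorted del: upt_Suc)
  qed
  show "r ^ iar ?\<pi> * p ^ ncomp ?\<pi> = (if m = 0 then (r * p) ^ n else r * p * r ^ (n - m - 1))"
  proof (cases "m = 0")
    case True
    with \<tau> up show ?thesis
      by (simp add: avoiders_pair_0 iar_sorted ncomp_identity power_mult_distrib del: upt_Suc)
  next
    case False
    have "iar ?\<pi> = n - m"
      using hd_less_Suc[OF \<tau> False] up last m by (subst iar_sorted_append) (auto simp del: upt_Suc)
    moreover have "ncomp ?\<pi> = 1"
      using False m \<tau> by (intro ncomp_132_213_word) (auto dest: set_avoiders length_avoiders)
    ultimately show ?thesis
      using False m by (simp add: power_eq_if[of r "n - m"])
  qed
qed auto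

lemma perm_gf_tilde_132_231:
  fixes t r p :: "'a :: field"
  assumes "r \<noteq> 0" "p \<noteq> 0"
  shows "perm_gf_tilde {[1,3,2], [2,3,1]} t r p =
           1 / (1 - fps_const r * fps_const p * fps_X) +
           fps_const t * fps_X / ((1 - fps_const p * fps_X) * (1 - fps_X - fps_const t * fps_X))"
proof (rule perm_gf_tilde_of_decomposition[OF assms _ avoiders_pair_0 bij_betw_avoiders_132_231])
  fix n m \<tau> assume m: "m < n" and \<tau>: "\<tau> \<in> avoiders m {[1,3,2], [2,3,1]}"
  let ?up = "[Suc (Suc m)..<Suc n]"
  let ?\<pi> = "Suc m # \<tau> @ ?up"
  have identity: "?\<pi> = [Suc 0..<Suc n]" if "m = 0"
    using that \<tau> m by (simp add: avoiders_pair_0 upt_conv_Cons del: upt_Suc)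
  \<comment> \<open>The final block lies above \<open>\<tau>\<close>, so the only new descent is the one after the first entry.\<close>
  have "des (\<tau> @ ?up) = des \<tau>" if "m \<noteq> 0"
  proof (cases "?up = []")
    case False
    have "last \<tau> < hd ?up"
      using hd_less_Suc[OF \<tau> that] set_avoiders[OF \<tau>] False last_in_set[of \<tau>]
      by (auto simp del: upt_Suc)
    then show ?thesis
      using hd_less_Suc[OF \<tau> that] False by (simp add: des_append des_sorted del: upt_Suc)
  qed (simp del: upt_Suc)
  then show "des ?\<pi> = (if m = 0 then 0 else Suc (des \<tau>))"
    using hd_less_Suc[OF \<tau>] identity des_append[of "[Suc m]" "\<tau> @ ?up"]
    by (auto simp: des_sorted des_singleton simp del: upt_Suc)
  have "ncomp ?\<pi> = n - m"
    using m \<tau> by (intro ncomp_132_231_word) (auto dest: set_avoiders length_avoiders)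
  moreover have "iar ?\<pi> = (if m = 0 then n else 1)"
    using hd_less_Suc[OF \<tau>] identity iar_sorted_append[of "[Suc m]" "\<tau> @ ?up"]
    by (auto simp: iar_sorted simp del: upt_Suc)
  ultimately show "r ^ iar ?\<pi> * p ^ ncomp ?\<pi> = (if m = 0 then (r * p) ^ n else r * p * p ^ (n - m - 1))"
    using m by (cases "m = 0") (simp_all add: power_mult_distrib power_eq_if[of p "n - m"] del: upt_Suc)
qed auto

theorem theorem4p8:
  fixes t r p z :: "rat_fun fps"
  defines "t \<equiv> fps_const t_var" and "r \<equiv> fps_const r_var" and "p \<equiv> fps_const p_var"
    and "z \<equiv> fps_X"
  shows "perm_gf_tilde {[1,3,2], [2,1,3]} t_var r_var p_var =
           1 / (1 - r * p * z) + t * z / ((1 - r * z) * (1 - z - t * z)) \<and>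
         perm_gf_tilde {[1,3,2], [2,3,1]} t_var r_var p_var =
           1 / (1 - r * p * z) + t * z / ((1 - p * z) * (1 - z - t * z))"
  unfolding t_def r_def p_def z_def
  using perm_gf_tilde_132_213 perm_gf_tilde_132_231 r_var_nonzero p_var_nonzero by blast

end
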